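(* Let $0\le\alpha<\frac{\pi}{2}$ and let $T\in\Pi_n^{\alpha}$. Then there exists a unitary matrix $U\in\mathcal{M}_n$ such that $$|T|\le\sec\alpha\,\left|(\mathfrak{R}T)^{\frac12}\,U\,(\mathfrak{R}T)^{\frac12}\right|.$$
   Context: $\mathcal{M}_n$ is the algebra of $n\times n$ complex matrices, $\mathfrak{R}T=\frac{T+T^*}{2}$ is the real part of $T\in\mathcal{M}_n$, $|X|=(X^*X)^{1/2}$ for $X\in\mathcal{M}_n$, and for Hermitian $X,Y$, $X\le Y$ means that $Y-X$ is positive semidefinite. For $0\le\alpha<\pi/2$, $\Pi_n^{\alpha}$ is the set of $A\in\mathcal{M}_n$ such that for every unit vector $x\in\mathbb{C}^n$ the number $z=\langle Ax,x\rangle$ satisfies $\mathfrak{R}(z)>0$ and $|\mathfrak{I}(z)|\le(\tan\alpha)\,\mathfrak{R}(z)$. *)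

theory Defs
  imports Complex_Main "Jordan_Normal_Form.Schur_Decomposition"
begin

definition hermitian_mat :: "complex mat \<Rightarrow> bool" where
  "hermitian_mat A \<longleftrightarrow> square_mat A \<and> mat_adjoint A = A"

definition unitary_mat :: "complex mat \<Rightarrow> bool" where
  "unitary_mat U \<longleftrightarrow> square_mat U
     \<and> mat_adjoint U * U = 1\<^sub>m (dim_row U) \<and> U * mat_adjoint U = 1\<^sub>m (dim_row U)"

(* \<langle>A x, x\<rangle>; the library product v \<bullet>c w = v \<bullet> conjugate w is linear in its first argument *)
definition quad_form :: "complex mat \<Rightarrow> complex vec \<Rightarrow> complex" where
  "quad_form A x = (A *\<^sub>v x) \<bullet>c x"

definition psd_mat :: "complex mat \<Rightarrow> bool" where
  "psd_mat A \<longleftrightarrow> hermitian_mat A \<and> (\<forall>x \<in> carrier_vec (dim_row A). 0 \<le> Re (quad_form A x))"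

definition loewner_le :: "complex mat \<Rightarrow> complex mat \<Rightarrow> bool" where
  "loewner_le X Y \<longleftrightarrow> hermitian_mat X \<and> hermitian_mat Y
     \<and> dim_row X = dim_row Y \<and> psd_mat (Y - X)"

(* Meaningful for positive semidefinite A only, where exactly one such B exists. *)
definition psd_sqrt :: "complex mat \<Rightarrow> complex mat" where
  "psd_sqrt A = (THE B. psd_mat B \<and> B * B = A)"

definition mat_abs :: "complex mat \<Rightarrow> complex mat" where
  "mat_abs X = psd_sqrt (mat_adjoint X * X)"

definition re_part :: "complex mat \<Rightarrow> complex mat" where
  "re_part T = (1/2) \<cdot>\<^sub>m (T + mat_adjoint T)"

definition sectorial :: "nat \<Rightarrow> real \<Rightarrow> complex mat set" where
  "sectorial n \<alpha> = {A \<in> carrier_mat n n. \<forall>x \<in> carrier_vec n. x \<bullet>c x = 1 \<longrightarrow>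
     Re (quad_form A x) > 0 \<and> \<bar>Im (quad_form A x)\<bar> \<le> tan \<alpha> * Re (quad_form A x)}"

end

theory Submission
  imports Defs
begin

text \<open>Let \<open>S = (Re T)\<^sup>1\<^sup>/\<^sup>2\<close>, which is invertible, and write \<open>T = S K S\<close>. Then \<open>Re K = 1\<close>, so
  \<open>K = 1 + \<i> C\<close> with \<open>C\<close> Hermitian, and the sector condition says that the numerical radius of \<open>C\<close>,
  hence its norm, is at most \<open>tan \<alpha>\<close>; thus \<open>K K\<^sup>* = 1 + C\<^sup>2 \<le> sec\<^sup>2 \<alpha>\<close>. By polar decomposition of
  \<open>S K\<close> there is a unitary \<open>Q\<close> with \<open>(S K)\<^sup>* (S K) = Q\<^sup>* (S K) (S K)\<^sup>* Q\<close>, and with \<open>X = S Q S\<close> this gives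
  \<open>T\<^sup>* T = X\<^sup>* (K K\<^sup>*) X \<le> sec\<^sup>2 \<alpha> X\<^sup>* X\<close>. Operator monotonicity of the square root finishes the proof,
  with \<open>U = Q\<close>.\<close>

section \<open>Adjoints and the complex inner product\<close>

lemma mat_adjoint_dim [simp]:
  "dim_row (mat_adjoint A) = dim_col A" "dim_col (mat_adjoint A) = dim_row A"
  by (auto simp: mat_adjoint_def mat_of_rows_def)

lemma mat_adjoint_carrier [simp]:
  "A \<in> carrier_mat n m \<Longrightarrow> mat_adjoint A \<in> carrier_mat m n"
  by (intro carrier_matI) auto

lemma mat_adjoint_index [simp]:
  fixes A :: "complex mat"
  assumes "i < dim_col A" "j < dim_row A"
  shows "mat_adjoint A $$ (i, j) = cnj (A $$ (j, i))"
  using assms by (simp add: mat_adjoint_def mat_of_rows_index cols_def)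

lemma mat_adjoint_adjoint [simp]:
  fixes A :: "complex mat"
  shows "mat_adjoint (mat_adjoint A) = A"
  by (rule eq_matI) auto

lemma mat_adjoint_one [simp]: "mat_adjoint (1\<^sub>m n :: complex mat) = 1\<^sub>m n"
  by (rule eq_matI) auto

lemma mat_adjoint_smult [simp]:
  fixes A :: "complex mat"
  shows "mat_adjoint (c \<cdot>\<^sub>m A) = cnj c \<cdot>\<^sub>m mat_adjoint A"
  by (rule eq_matI) auto

lemma mat_adjoint_add [simp]:
  fixes A B :: "complex mat"
  assumes "A \<in> carrier_mat n m" "B \<in> carrier_mat n m"
  shows "mat_adjoint (A + B) = mat_adjoint A + mat_adjoint B"
  using assms by (intro eq_matI) auto

lemma mat_adjoint_minus [simp]:
  fixes A B :: "complex mat"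
  assumes "A \<in> carrier_mat n m" "B \<in> carrier_mat n m"
  shows "mat_adjoint (A - B) = mat_adjoint A - mat_adjoint B"
  using assms by (intro eq_matI) auto

lemma mat_adjoint_mult [simp]:
  fixes A B :: "complex mat"
  assumes "A \<in> carrier_mat n m" "B \<in> carrier_mat m k"
  shows "mat_adjoint (A * B) = mat_adjoint B * mat_adjoint A"
  using assms by (intro eq_matI) (auto simp: scalar_prod_def intro!: sum.cong)

lemma mat_adjoint_diag [simp]:
  "mat_adjoint (mat_diag n (\<lambda>i. complex_of_real (d i))) = mat_diag n (\<lambda>i. complex_of_real (d i))"
  by (rule eq_matI) (auto simp: mat_diag_def)

lemma cscalar_prod_adjoint:
  fixes A :: "complex mat"
  assumes "A \<in> carrier_mat n m" "x \<in> carrier_vec m" "y \<in> carrier_vec n"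
  shows "(A *\<^sub>v x) \<bullet>c y = x \<bullet>c (mat_adjoint A *\<^sub>v y)"
proof -
  have "(A *\<^sub>v x) \<bullet>c y = (\<Sum>i<n. \<Sum>j<m. A $$ (i, j) * x $ j * cnj (y $ i))"
    using assms by (auto simp: scalar_prod_def atLeast0LessThan sum_distrib_right intro!: sum.cong)
  also have "\<dots> = (\<Sum>j<m. \<Sum>i<n. A $$ (i, j) * x $ j * cnj (y $ i))"
    by (rule sum.swap)
  also have "\<dots> = x \<bullet>c (mat_adjoint A *\<^sub>v y)"
    using assms by (auto simp: scalar_prod_def atLeast0LessThan sum_distrib_left mult_ac intro!: sum.cong)
  finally show ?thesis .
qed

lemma cscalar_prod_self:
  fixes x :: "complex vec"
  assumes "x \<in> carrier_vec n"
  shows "x \<bullet>c x = complex_of_real (\<Sum>i<n. (cmod (x $ i))\<^sup>2)"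
  using assms
  by (simp add: scalar_prod_def atLeast0LessThan complex_norm_square[symmetric] del: of_real_power)

lemma cscalar_prod_self_real:
  fixes x :: "complex vec"
  shows "x \<bullet>c x = complex_of_real (Re (x \<bullet>c x))" "0 \<le> Re (x \<bullet>c x)"
  using cscalar_prod_self[OF carrier_vec_dim_vec, of x] by (simp_all add: sum_nonneg)

lemma cscalar_prod_self_pos:
  fixes x :: "complex vec"
  assumes "x \<in> carrier_vec n" "x \<noteq> 0\<^sub>v n"
  shows "0 < Re (x \<bullet>c x)"
  using conjugate_square_greater_0_vec[OF assms(1)] assms(2) by (simp add: less_complex_def)

section \<open>Unitary bases and the spectral theorem for Hermitian matrices\<close>

lemma hermitian_mat_carrier:
  assumes "A \<in> carrier_mat n n"
  shows "hermitian_mat A \<longleftrightarrow> mat_adjoint A = A"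
  using assms by (auto simp: hermitian_mat_def)

lemma unitary_matI:
  assumes "U \<in> carrier_mat n n" "mat_adjoint U * U = 1\<^sub>m n"
  shows "unitary_mat U"
  using assms mat_mult_left_right_inverse[of "mat_adjoint U" n U] by (auto simp: unitary_mat_def)

text \<open>Complete \<open>v\<close> to a basis and orthogonalise it: Gram-Schmidt keeps the first
  vector, and normalising only rescales it, which is where the factor \<open>c\<close> comes from.
  This supplies the change of basis that splits off one eigenvector in the spectral theorem.\<close>

lemma unitary_completion:
  fixes v :: "complex vec"
  assumes v: "v \<in> carrier_vec n" "v \<noteq> 0\<^sub>v n"
  obtains U c where "U \<in> carrier_mat n n" "mat_adjoint U * U = 1\<^sub>m n" "col U 0 = c \<cdot>\<^sub>v v"
proof -
  interpret cof_vec_space n "TYPE(complex)" .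
  have n: "0 < n" using v by (cases n) auto
  define b where "b = basis_completion v"
  define ws where "ws = gram_schmidt n b"
  from basis_completion[OF v, folded b_def]
  have dist_b: "distinct b" and indep: "\<not> lin_dep (set b)" and b: "set b \<subseteq> carrier_vec n"
    and hdb: "hd b = v" and len_b: "length b = n" by auto
  from hdb len_b n obtain vs where bv: "b = v # vs" by (cases b) auto
  from gram_schmidt_result[OF b dist_b indep refl, folded ws_def]
  have ws: "set ws \<subseteq> carrier_vec n" "corthogonal ws" "length ws = n"
    by (auto simp: len_b)
  from gram_schmidt_hd[OF v(1), of vs, folded bv] have hdws: "hd ws = v" unfolding ws_def .
  \<comment> \<open>The vectors in \<open>ws\<close> are orthogonal but not normalised;
    \<open>r w\<close> is the reciprocal of the norm of \<open>w\<close>.\<close>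
  define r where "r w = complex_of_real (1 / sqrt (Re (w \<bullet>c w)))" for w :: "complex vec"
  define U where "U = mat_of_cols n (map (\<lambda>w. r w \<cdot>\<^sub>v w) ws)"
  have wsc: "ws ! i \<in> carrier_vec n" if "i < n" for i
    using ws that by auto
  have U: "U \<in> carrier_mat n n"
    using ws(3) mat_of_cols_carrier(1)[of n "map (\<lambda>w. r w \<cdot>\<^sub>v w) ws"] by (simp add: U_def)
  have colU: "col U i = r (ws ! i) \<cdot>\<^sub>v ws ! i" if "i < n" for i
    unfolding U_def using that ws wsc by (subst col_mat_of_cols) auto
  have "mat_adjoint U * U = 1\<^sub>m n"
  proof (rule eq_matI)
    fix i j assume "i < dim_row (1\<^sub>m n :: complex mat)" "j < dim_col (1\<^sub>m n :: complex mat)"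
    hence ij: "i < n" "j < n" by auto
    have "(mat_adjoint U * U) $$ (i, j) = col U j \<bullet>c col U i"
      using U ij by (auto simp: scalar_prod_def mult_ac intro!: sum.cong)
    also have "\<dots> = r (ws ! j) * cnj (r (ws ! i)) * (ws ! j \<bullet>c ws ! i)"
      using ij wsc[OF ij(1)] wsc[OF ij(2)]
      by (simp add: colU conjugate_smult_vec smult_scalar_prod_distrib[of _ n]
          scalar_prod_smult_distrib[of _ n])
    also have "\<dots> = (if i = j then 1 else 0)"
    proof (cases "i = j")
      case True
      define q where "q = Re (ws ! i \<bullet>c ws ! i)"
      have q: "ws ! i \<bullet>c ws ! i = complex_of_real q" "0 \<le> q"
        unfolding q_def by (rule cscalar_prod_self_real)+
      have "ws ! i \<bullet>c ws ! i \<noteq> 0"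
        using corthogonalD[OF ws(2), of i i] ij ws(3) by simp
      hence "0 < q" using q by simp
      have "r (ws ! i) * cnj (r (ws ! i)) * complex_of_real q
          = complex_of_real (1 / sqrt q * (1 / sqrt q) * q)"
        unfolding r_def q_def[symmetric] by (simp only: complex_cnj_complex_of_real of_real_mult)
      also have "1 / sqrt q * (1 / sqrt q) * q = 1"
        using \<open>0 < q\<close> by simp
      finally show ?thesis
        using True q(1) by simp
    next
      case False
      thus ?thesis
        using corthogonalD[OF ws(2), of j i] ij ws(3) by auto
    qed
    finally show "(mat_adjoint U * U) $$ (i, j) = 1\<^sub>m n $$ (i, j)" using ij by simp
  qed (use U in auto)
  moreover have "col U 0 = r v \<cdot>\<^sub>v v"
    using colU[OF n] hdws hd_conv_nth[of ws] n ws by auto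
  ultimately show thesis using U that by blast
qed

lemma hermitian_eigenvalue_real:
  assumes A: "A \<in> carrier_mat n n" "mat_adjoint A = A"
    and v: "v \<in> carrier_vec n" "v \<noteq> 0\<^sub>v n" "A *\<^sub>v v = e \<cdot>\<^sub>v v"
  shows "e = complex_of_real (Re e)"
proof -
  have "(A *\<^sub>v v) \<bullet>c v = v \<bullet>c (A *\<^sub>v v)"
    using cscalar_prod_adjoint[OF A(1) v(1) v(1)] A(2) by simp
  hence "e * (v \<bullet>c v) = cnj e * (v \<bullet>c v)"
    using v by (simp add: conjugate_smult_vec)
  moreover have "v \<bullet>c v \<noteq> 0"
    using v by simp
  ultimately have "e = cnj e" by simp
  thus ?thesis by (metis Reals_cnj_iff of_real_Re)
qed

text \<open>Over the complex numbers the characteristic polynomial splits into n linear factors, and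
  for n > 0 there is at least one of them.\<close>

lemma ex_eigenvector:
  fixes A :: "complex mat"
  assumes A: "A \<in> carrier_mat n n" and n: "0 < n"
  obtains e v where "v \<in> carrier_vec n" "v \<noteq> 0\<^sub>v n" "A *\<^sub>v v = e \<cdot>\<^sub>v v"
proof -
  from char_poly_factorized[OF A] obtain as where
    "char_poly A = (\<Prod>a\<leftarrow>as. [:- a, 1:])" "length as = n" by blast
  with n obtain e as' where "char_poly A = [:- e, 1:] * (\<Prod>a\<leftarrow>as'. [:- a, 1:])"
    by (cases as) auto
  hence "eigenvalue A e"
    unfolding eigenvalue_root_char_poly[OF A] by simp
  thus thesis using that A by (auto simp: eigenvalue_def eigenvector_def)
qed

text \<open>Deflation, by induction on n. In a unitary basis \<open>W\<close> that starts with an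
  eigenvector, the first column of the matrix is (e, 0, ..., 0), and by Hermitian symmetry so is its
  first row. The remaining block is Hermitian of size n and is diagonalised by the induction
  hypothesis.\<close>

theorem hermitian_spectral:
  assumes "A \<in> carrier_mat n n" "mat_adjoint A = A"
  shows "\<exists>U d. U \<in> carrier_mat n n \<and> mat_adjoint U * U = 1\<^sub>m n \<and>
    mat_adjoint U * A * U = mat_diag n (\<lambda>i. complex_of_real (d i))"
  using assms
proof (induction n arbitrary: A)
  case 0
  thus ?case by (intro exI[of _ "1\<^sub>m 0"] exI[of _ "\<lambda>_. 0"]) (auto simp: mat_diag_def)
next
  case (Suc n)
  note A = Suc.prems
  obtain e v where
    v: "v \<in> carrier_vec (Suc n)" "v \<noteq> 0\<^sub>v (Suc n)" "A *\<^sub>v v = e \<cdot>\<^sub>v v"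
    by (rule ex_eigenvector[OF A(1) zero_less_Suc])
  note e = hermitian_eigenvalue_real[OF A v]
  from unitary_completion[OF v(1,2)] obtain W c where
    W: "W \<in> carrier_mat (Suc n) (Suc n)" "mat_adjoint W * W = 1\<^sub>m (Suc n)" "col W 0 = c \<cdot>\<^sub>v v" .
  define B where "B = mat_adjoint W * A * W"
  have B: "B \<in> carrier_mat (Suc n) (Suc n)" using W A by (auto simp: B_def)
  have Bh: "mat_adjoint B = B"
    using W A by (simp add: B_def assoc_mult_mat[of _ "Suc n" "Suc n" _ "Suc n" _ "Suc n"]
      mat_adjoint_mult[of _ "Suc n" "Suc n" _ "Suc n"])
  \<comment> \<open>Column 0 of \<open>W\<close> is an eigenvector, so entry (i, 0) of
    \<open>B\<close> is e times entry (i, 0) of \<open>mat_adjoint W * W\<close>, which is the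
    identity.\<close>
  have col0: "B $$ (i, 0) = (if i = 0 then e else 0)" if i: "i < Suc n" for i
  proof -
    have "B = mat_adjoint W * (A * W)"
      using W A by (simp add: B_def assoc_mult_mat[of _ "Suc n" "Suc n" _ "Suc n" _ "Suc n"])
    hence "B $$ (i, 0) = row (mat_adjoint W) i \<bullet> (A *\<^sub>v col W 0)"
      using i W(1) A(1) by (simp flip: col_mult2[OF A(1) W(1) zero_less_Suc])
    also have "A *\<^sub>v col W 0 = e \<cdot>\<^sub>v col W 0"
      using W(3) A v by (simp add: mult_mat_vec[of _ "Suc n" "Suc n"] smult_smult_assoc mult.commute)
    also have "row (mat_adjoint W) i \<bullet> (e \<cdot>\<^sub>v col W 0) = e * (mat_adjoint W * W) $$ (i, 0)"
      using i W(1) by simp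
    finally show ?thesis unfolding W(2) using i by simp
  qed
  have row0: "B $$ (0, j) = 0" if "0 < j" "j < Suc n" for j
    using col0[of j] that B arg_cong[OF Bh, of "\<lambda>M. M $$ (0, j)"] by simp
  define B' where "B' = mat n n (\<lambda>(i, j). B $$ (Suc i, Suc j))"
  have B': "B' \<in> carrier_mat n n" by (simp add: B'_def)
  have "mat_adjoint B' = B'"
  proof (rule eq_matI)
    fix i j assume "i < dim_row B'" "j < dim_col B'"
    thus "mat_adjoint B' $$ (i, j) = B' $$ (i, j)"
      using B B' arg_cong[OF Bh, of "\<lambda>M. M $$ (Suc i, Suc j)"] by (simp add: B'_def)
  qed (use B' in auto)
  from Suc.IH[OF B' this] obtain V d where
    V: "V \<in> carrier_mat n n" "mat_adjoint V * V = 1\<^sub>m n"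
      "mat_adjoint V * B' * V = mat_diag n (\<lambda>i. complex_of_real (d i))" by blast
  let ?blk = "\<lambda>a M. four_block_mat (mat 1 1 (\<lambda>_. a)) (0\<^sub>m 1 n) (0\<^sub>m n 1) M :: complex mat"
  have Bblk: "B = ?blk e B'"
  proof (rule eq_matI)
    fix i j assume "i < dim_row (?blk e B')" "j < dim_col (?blk e B')"
    thus "B $$ (i, j) = ?blk e B' $$ (i, j)"
      using col0[of i] row0[of j] B' by (cases i; cases j) (auto simp: B'_def)
  qed (use B B' in auto)
  \<comment> \<open>Block-diagonal matrices multiply blockwise. Together with the formula for the
    adjoint below, this passes unitarity from \<open>V\<close> to \<open>E\<close> and reduces the
    conjugation of \<open>B\<close> by \<open>E\<close> to that of \<open>B'\<close> by
    \<open>V\<close>.\<close>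
  have blk_mult: "?blk a M * ?blk b N = ?blk (a * b) (M * N)"
    if "M \<in> carrier_mat n n" "N \<in> carrier_mat n n" for a b M N
    by (subst mult_four_block_mat[where ?nr1.0 = 1 and ?nr2.0 = n and ?n1.0 = 1 and ?n2.0 = n
          and ?nc1.0 = 1 and ?nc2.0 = n])
      (use that in \<open>auto intro!: cong_four_block_mat simp: scalar_prod_def\<close>)
  have blk_adj: "mat_adjoint (?blk 1 V) = ?blk 1 (mat_adjoint V)"
    using V by (intro eq_matI) auto
  define E where "E = ?blk 1 V"
  define E' where "E' = ?blk 1 (mat_adjoint V)"
  define U where "U = W * E"
  have E: "E \<in> carrier_mat (Suc n) (Suc n)" "E' \<in> carrier_mat (Suc n) (Suc n)"
    unfolding E_def E'_def using V by (intro carrier_matI; simp)+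
  have U: "U \<in> carrier_mat (Suc n) (Suc n)" using W E by (auto simp: U_def)
  note assoc = assoc_mult_mat[of _ "Suc n" "Suc n" _ "Suc n" _ "Suc n"]
    mult_carrier_mat[of _ "Suc n" "Suc n" _ "Suc n"]
  have adjE: "mat_adjoint E = E'"
    unfolding E_def E'_def by (rule blk_adj)
  have adjU: "mat_adjoint U = E' * mat_adjoint W"
    unfolding U_def mat_adjoint_mult[OF W(1) E(1)] adjE ..
  have "mat_adjoint U * U = E' * (mat_adjoint W * W) * E"
    unfolding adjU unfolding U_def using W(1) E by (simp add: assoc)
  also have "\<dots> = E' * E"
    unfolding W(2) using E by simp
  also have "\<dots> = 1\<^sub>m (Suc n)"
    using V(1) unfolding E_def E'_def by (subst blk_mult) (auto simp: V(2) intro!: eq_matI)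
  finally have U1: "mat_adjoint U * U = 1\<^sub>m (Suc n)" .
  have "mat_adjoint U * A * U = E' * B * E"
    unfolding adjU B_def unfolding U_def using W(1) E A(1) by (simp add: assoc)
  also have "\<dots> = ?blk e (mat_adjoint V * B' * V)"
    unfolding Bblk E_def E'_def using V(1) B'
    by (simp add: blk_mult mult_carrier_mat[of _ n n _ n] del: One_nat_def)
  \<comment> \<open>\<open>case_nat (Re e) d\<close> puts the split-off eigenvalue in front of the
    list \<open>d\<close>; replacing e by its real part is legitimate because eigenvalues of
    Hermitian matrices are real.\<close>
  also have "\<dots> = mat_diag (Suc n) (\<lambda>i. complex_of_real (case_nat (Re e) d i))"
    unfolding V(3) by (intro eq_matI) (use e in \<open>auto simp: mat_diag_def split: nat.split\<close>)
  finally show ?case using U U1 by blast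
qed

section \<open>Positive semidefinite matrices and their square roots\<close>

lemma psd_mat_iff:
  assumes "A \<in> carrier_mat n n"
  shows "psd_mat A \<longleftrightarrow> mat_adjoint A = A \<and> (\<forall>x \<in> carrier_vec n. 0 \<le> Re ((A *\<^sub>v x) \<bullet>c x))"
  using assms by (auto simp: psd_mat_def hermitian_mat_carrier quad_form_def)

text \<open>The quadratic form of the product at x is that of \<open>A\<close> at
  \<open>B *\<^sub>v x\<close>. The lemma carries positivity from a diagonal matrix to any unitary
  conjugate of it, and in the main proof it carries an operator bound through a congruence.\<close>

lemma psd_mat_congruence:
  assumes A: "A \<in> carrier_mat n n" "psd_mat A" and B: "B \<in> carrier_mat n n"
  shows "psd_mat (mat_adjoint B * A * B)"
proof -
  have "((mat_adjoint B * A * B) *\<^sub>v x) \<bullet>c x = (A *\<^sub>v (B *\<^sub>v x)) \<bullet>c (B *\<^sub>v x)"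
    if x: "x \<in> carrier_vec n" for x
    using A(1) B x cscalar_prod_adjoint[of "mat_adjoint B" n n "A *\<^sub>v (B *\<^sub>v x)" x]
    by (simp add: assoc_mult_mat_vec[of _ n n _ n] mult_carrier_mat[of _ n n _ n] mult_mat_vec_carrier[of _ n n])
  moreover have "mat_adjoint (mat_adjoint B * A * B) = mat_adjoint B * A * B"
    using A B by (simp add: psd_mat_iff mat_adjoint_mult[of _ n n _ n] assoc_mult_mat[of _ n n _ n _ n] mult_carrier_mat[of _ n n _ n])
  ultimately show ?thesis
    using A B psd_mat_iff[of "mat_adjoint B * A * B" n] psd_mat_iff[of A n]
      mult_carrier_mat[OF mult_carrier_mat[OF mat_adjoint_carrier[OF B] A(1)] B]
      mult_mat_vec_carrier[OF B] by simp
qed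

lemma psd_mat_diag:
  assumes "\<And>i. i < n \<Longrightarrow> 0 \<le> d i"
  shows "psd_mat (mat_diag n (\<lambda>i. complex_of_real (d i)))"
proof -
  have "0 \<le> Re ((mat_diag n (\<lambda>i. complex_of_real (d i)) *\<^sub>v x) \<bullet>c x)" if x: "x \<in> carrier_vec n" for x
  proof -
    have "(mat_diag n (\<lambda>i. complex_of_real (d i)) *\<^sub>v x) $ i = complex_of_real (d i) * x $ i"
      if "i < n" for i
    proof -
      have "(mat_diag n (\<lambda>i. complex_of_real (d i)) *\<^sub>v x) $ i
          = (\<Sum>j = 0..<n. (if i = j then complex_of_real (d j) else 0) * x $ j)"
        using x that by (simp add: mat_diag_def scalar_prod_def)
      also have "\<dots> = (\<Sum>j = 0..<n. if i = j then complex_of_real (d j) * x $ j else 0)"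
        by (intro sum.cong) auto
      finally show ?thesis using that by simp
    qed
    hence "(mat_diag n (\<lambda>i. complex_of_real (d i)) *\<^sub>v x) \<bullet>c x
        = (\<Sum>i = 0..<n. complex_of_real (d i * (cmod (x $ i))\<^sup>2))"
      using x by (auto simp: scalar_prod_def mult.assoc complex_norm_square[symmetric] intro!: sum.cong
          simp del: of_real_power)
    thus ?thesis using assms by (auto intro!: sum_nonneg)
  qed
  thus ?thesis by (simp add: psd_mat_iff[of _ n])
qed

text \<open>The spectral theorem in the two forms used later: as a factorization, for computing with
  functions of \<open>A\<close>, and as a family of unit eigenvectors, for reading off bounds on the
  eigenvalues \<open>d i\<close>.\<close>

lemma hermitian_eigenbasis:
  assumes A: "A \<in> carrier_mat n n" "mat_adjoint A = A"
  obtains U d where "U \<in> carrier_mat n n" "mat_adjoint U * U = 1\<^sub>m n" "U * mat_adjoint U = 1\<^sub>m n"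
    "A = U * mat_diag n (\<lambda>i. complex_of_real (d i)) * mat_adjoint U"
    "\<And>i. i < n \<Longrightarrow> A *\<^sub>v col U i = complex_of_real (d i) \<cdot>\<^sub>v col U i"
    "\<And>i. i < n \<Longrightarrow> col U i \<bullet>c col U i = 1"
proof -
  from hermitian_spectral[OF A] obtain U d where U: "U \<in> carrier_mat n n" "mat_adjoint U * U = 1\<^sub>m n"
    and D: "mat_adjoint U * A * U = mat_diag n (\<lambda>i. complex_of_real (d i))" by blast
  let ?D = "mat_diag n (\<lambda>i. complex_of_real (d i))"
  note assoc = assoc_mult_mat[of _ n n _ n _ n] mult_carrier_mat[of _ n n _ n]
  have UU: "U * mat_adjoint U = 1\<^sub>m n"
    using mat_mult_left_right_inverse[of "mat_adjoint U" n U] U by simp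
  have "U * ?D = (U * mat_adjoint U) * A * U"
    unfolding D[symmetric] using U(1) A(1) by (simp add: assoc)
  hence UD: "U * ?D = A * U"
    unfolding UU using U(1) A(1) by simp
  have "A = A * (U * mat_adjoint U)"
    unfolding UU using A(1) by simp
  hence *: "A = U * ?D * mat_adjoint U"
    unfolding UD using U(1) A(1) by (simp add: assoc)
  have eig: "A *\<^sub>v col U i = complex_of_real (d i) \<cdot>\<^sub>v col U i" if i: "i < n" for i
  proof -
    have "A *\<^sub>v col U i = col (U * ?D) i"
      unfolding UD by (rule col_mult2[OF A(1) U(1) i, symmetric])
    also have "\<dots> = complex_of_real (d i) \<cdot>\<^sub>v col U i"
      using U(1) i by (intro eq_vecI) (auto simp: mat_diag_mult_right mult.commute)
    finally show ?thesis .
  qed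
  have "col U i \<bullet>c col U i = 1" if i: "i < n" for i
  proof -
    have "col U i \<bullet>c col U i = (mat_adjoint U * U) $$ (i, i)"
      using U(1) i by (simp add: scalar_prod_def mult.commute)
    thus ?thesis unfolding U(2) using i by simp
  qed
  thus thesis using that U UU * eig by blast
qed

text \<open>The columns of the diagonalising unitary are unit eigenvectors, so the hypothesis makes
  the diagonal nonnegative, and congruence transfers positivity to \<open>A\<close>.\<close>

lemma psd_mat_eigenvalueI:
  assumes A: "A \<in> carrier_mat n n" "mat_adjoint A = A"
    and nonneg: "\<And>v c. v \<in> carrier_vec n \<Longrightarrow> v \<bullet>c v = 1 \<Longrightarrow>
      A *\<^sub>v v = complex_of_real c \<cdot>\<^sub>v v \<Longrightarrow> 0 \<le> c"
  shows "psd_mat A"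
proof -
  obtain U d where U: "U \<in> carrier_mat n n" "A = U * mat_diag n (\<lambda>i. complex_of_real (d i)) * mat_adjoint U"
    "\<And>i. i < n \<Longrightarrow> A *\<^sub>v col U i = complex_of_real (d i) \<cdot>\<^sub>v col U i"
    "\<And>i. i < n \<Longrightarrow> col U i \<bullet>c col U i = 1"
    by (rule hermitian_eigenbasis[OF A]) blast
  have "psd_mat (mat_diag n (\<lambda>i. complex_of_real (d i)))"
    using nonneg[OF _ U(4,3)] U(1) by (intro psd_mat_diag) auto
  from psd_mat_congruence[OF _ this, of n "mat_adjoint U"] U(1)
  show ?thesis unfolding U(2) by simp
qed

lemma psd_mat_eigenvalueD:
  assumes "A \<in> carrier_mat n n" "psd_mat A"
    and "v \<in> carrier_vec n" "v \<bullet>c v = 1" "A *\<^sub>v v = complex_of_real c \<cdot>\<^sub>v v"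
  shows "0 \<le> c"
proof -
  have "0 \<le> Re ((A *\<^sub>v v) \<bullet>c v)"
    using assms(1-3) by (simp add: psd_mat_iff)
  thus ?thesis using assms(3-5) by (simp add: smult_scalar_prod_distrib[of _ n])
qed

text \<open>Take square roots of the eigenvalues in a diagonalisation; positivity of
  \<open>A\<close> makes them nonnegative.\<close>

lemma psd_mat_sqrt_exists:
  assumes A: "A \<in> carrier_mat n n" "psd_mat A"
  shows "\<exists>B \<in> carrier_mat n n. psd_mat B \<and> B * B = A"
proof -
  have Ah: "mat_adjoint A = A" using A by (simp add: psd_mat_iff)
  obtain U d where U: "U \<in> carrier_mat n n" "mat_adjoint U * U = 1\<^sub>m n"
    "A = U * mat_diag n (\<lambda>i. complex_of_real (d i)) * mat_adjoint U"
    "\<And>i. i < n \<Longrightarrow> A *\<^sub>v col U i = complex_of_real (d i) \<cdot>\<^sub>v col U i"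
    "\<And>i. i < n \<Longrightarrow> col U i \<bullet>c col U i = 1"
    by (rule hermitian_eigenbasis[OF A(1) Ah]) blast
  have d: "0 \<le> d i" if "i < n" for i
    using psd_mat_eigenvalueD[OF A _ U(5,4)] U(1) that by simp
  let ?S = "mat_diag n (\<lambda>i. complex_of_real (sqrt (d i)))"
  define B where "B = U * ?S * mat_adjoint U"
  have "B * B = U * ?S * (mat_adjoint U * U) * ?S * mat_adjoint U"
    using U(1) by (simp add: B_def assoc_mult_mat[of _ n n _ n _ n] mult_carrier_mat[of _ n n _ n])
  also have "\<dots> = U * (?S * ?S) * mat_adjoint U"
    unfolding U(2) using U(1) by (simp add: left_mult_one_mat[of _ n n] assoc_mult_mat[of _ n n _ n _ n] mult_carrier_mat[of _ n n _ n])
  also have "?S * ?S = mat_diag n (\<lambda>i. complex_of_real (d i))"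
    unfolding mat_diag_diag using d by (intro eq_matI) (auto simp: mat_diag_def simp flip: of_real_mult)
  finally have "B * B = A" unfolding U(3) .
  moreover have "psd_mat ?S" using d by (intro psd_mat_diag) simp
  from psd_mat_congruence[OF _ this, of n "mat_adjoint U"] U(1)
  have "psd_mat B" by (simp add: B_def)
  moreover have "B \<in> carrier_mat n n" using U(1) by (simp add: B_def mult_carrier_mat[of _ n n _ n])
  ultimately show ?thesis by blast
qed

text \<open>With \<open>Z = Y - X\<close> one has \<open>Y\<^sup>2 - X\<^sup>2 = Y Z + Z X\<close>, so a unit eigenvector \<open>v\<close> of \<open>Z\<close> with
  eigenvalue \<open>c\<close> satisfies \<open>c (\<langle>Y v, v\<rangle> + \<langle>X v, v\<rangle>) \<ge> 0\<close>.\<close>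
lemma psd_mat_sqrt_mono:
  assumes X: "X \<in> carrier_mat n n" "psd_mat X" and Y: "Y \<in> carrier_mat n n" "psd_mat Y"
    and le: "psd_mat (Y * Y - X * X)"
  shows "psd_mat (Y - X)"
proof (rule psd_mat_eigenvalueI)
  have h: "mat_adjoint X = X" "mat_adjoint Y = Y" using X Y by (auto simp: psd_mat_iff)
  show Z: "Y - X \<in> carrier_mat n n" "mat_adjoint (Y - X) = Y - X"
    using X Y by (auto simp: mat_adjoint_minus[of _ n n] h)
  fix v c assume v: "v \<in> carrier_vec n" "v \<bullet>c v = 1" and eig: "(Y - X) *\<^sub>v v = complex_of_real c \<cdot>\<^sub>v v"
  define x where "x = Re ((X *\<^sub>v v) \<bullet>c v)"
  define y where "y = Re ((Y *\<^sub>v v) \<bullet>c v)"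
  have xy: "0 \<le> x" "0 \<le> y" using X Y v by (auto simp: x_def y_def psd_mat_iff)
  have "Y * Y - X * X = Y * (Y - X) + (Y - X) * X"
    using X(1) Y(1) by (simp add: mult_minus_distrib_mat[of _ n n _ n] minus_mult_distrib_mat[of _ n n _ _ n])
      (auto intro!: eq_matI)
  hence "(Y * Y - X * X) *\<^sub>v v = Y *\<^sub>v ((Y - X) *\<^sub>v v) + (Y - X) *\<^sub>v (X *\<^sub>v v)"
    using X(1) Y(1) Z(1) v by (simp add: add_mult_distrib_mat_vec[of _ n n] assoc_mult_mat_vec[of _ n n _ n] mult_carrier_mat[of _ n n _ n] mult_mat_vec_carrier[of _ n n])
  hence "((Y * Y - X * X) *\<^sub>v v) \<bullet>c v = (Y *\<^sub>v ((Y - X) *\<^sub>v v)) \<bullet>c v + ((Y - X) *\<^sub>v (X *\<^sub>v v)) \<bullet>c v"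
    using X(1) Y(1) Z(1) v by (simp add: add_scalar_prod_distrib[of _ n] mult_mat_vec_carrier[of _ n n])
  also have "((Y - X) *\<^sub>v (X *\<^sub>v v)) \<bullet>c v = (X *\<^sub>v v) \<bullet>c ((Y - X) *\<^sub>v v)"
    using cscalar_prod_adjoint[OF Z(1), of "X *\<^sub>v v" v] Z X(1) v by simp
  finally have "Re (((Y * Y - X * X) *\<^sub>v v) \<bullet>c v) = c * (y + x)"
    unfolding eig using X(1) Y(1) v
    by (simp add: mult_mat_vec[of _ n n] conjugate_smult_vec x_def y_def algebra_simps)
  moreover have "0 \<le> Re (((Y * Y - X * X) *\<^sub>v v) \<bullet>c v)"
    using le v psd_mat_iff[OF minus_carrier_mat[OF mult_carrier_mat[OF X(1) X(1)]], of "Y * Y"] by blast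
  ultimately have *: "0 \<le> c * (y + x)" by simp
  \<comment> \<open>The inequality just obtained says nothing about c if x + y = 0. The second
    expression c = y - x covers this case: a negative c would force x + y \<le> 0, hence x = y = 0
    and c = 0.\<close>
  have "Re (((Y - X) *\<^sub>v v) \<bullet>c v) = y - x"
    using X(1) Y(1) v by (simp add: minus_mult_distrib_mat_vec[of _ n n] minus_scalar_prod_distrib[of _ n] x_def y_def)
  hence c: "c = y - x" unfolding eig using v by simp
  show "0 \<le> c"
  proof (rule ccontr)
    assume "\<not> 0 \<le> c"
    hence "y + x \<le> 0" using * by (simp add: zero_le_mult_iff)
    thus False using c xy \<open>\<not> 0 \<le> c\<close> by simp
  qed
qed

text \<open>Every eigenvalue of the Hermitian matrix \<open>Y - X\<close> is both nonnegative and
  nonpositive, so its diagonalisation is the zero matrix.\<close>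

lemma psd_mat_antisym:
  assumes X: "X \<in> carrier_mat n n" and Y: "Y \<in> carrier_mat n n"
    and le: "psd_mat (Y - X)" "psd_mat (X - Y)"
  shows "X = Y"
proof -
  have Zc: "Y - X \<in> carrier_mat n n" using X Y by auto
  have Zh: "mat_adjoint (Y - X) = Y - X"
    using le(1) psd_mat_iff[OF Zc] by blast
  note Z = Zc Zh
  obtain U d where U: "U \<in> carrier_mat n n"
    "Y - X = U * mat_diag n (\<lambda>i. complex_of_real (d i)) * mat_adjoint U"
    "\<And>i. i < n \<Longrightarrow> (Y - X) *\<^sub>v col U i = complex_of_real (d i) \<cdot>\<^sub>v col U i"
    "\<And>i. i < n \<Longrightarrow> col U i \<bullet>c col U i = 1"
    by (rule hermitian_eigenbasis[OF Z]) blast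
  have "d i = 0" if i: "i < n" for i
  proof (rule antisym)
    have cu: "col U i \<in> carrier_vec n" using U(1) i by simp
    show "0 \<le> d i" using psd_mat_eigenvalueD[OF Z(1) le(1) cu U(4,3)[OF i]] .
    have "(X - Y) *\<^sub>v col U i = - ((Y - X) *\<^sub>v col U i)"
      using X Y cu by (simp add: minus_mult_distrib_mat_vec[of _ n n]) (intro eq_vecI, auto)
    also have "\<dots> = complex_of_real (- d i) \<cdot>\<^sub>v col U i"
      unfolding U(3)[OF i] by (intro eq_vecI) auto
    finally have eq: "(X - Y) *\<^sub>v col U i = complex_of_real (- d i) \<cdot>\<^sub>v col U i" .
    have "0 \<le> - d i"
      by (rule psd_mat_eigenvalueD[OF minus_carrier_mat[OF Y] le(2) cu U(4)[OF i] eq])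
    thus "d i \<le> 0" by simp
  qed
  hence "mat_diag n (\<lambda>i. complex_of_real (d i)) = 0\<^sub>m n n"
    by (intro eq_matI) (auto simp: mat_diag_def)
  hence "Y - X = 0\<^sub>m n n" using U(1,2) by simp
  hence "(Y - X) $$ (i, j) = 0" if "i < n" "j < n" for i j using that by simp
  thus ?thesis using X Y by (intro eq_matI) auto
qed

text \<open>Uniqueness comes from monotonicity: the squares differ by the zero matrix, which is
  positive semidefinite, so \<open>X\<close> and \<open>Y\<close> dominate each other.\<close>

lemma psd_mat_sqrt_unique:
  assumes "X \<in> carrier_mat n n" "psd_mat X" "Y \<in> carrier_mat n n" "psd_mat Y" "X * X = Y * Y"
  shows "X = Y"
proof (rule psd_mat_antisym)
  have "psd_mat (mat_diag n (\<lambda>i. complex_of_real 0))" by (rule psd_mat_diag) simp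
  moreover have "mat_diag n (\<lambda>i. complex_of_real 0) = 0\<^sub>m n n"
    by (intro eq_matI) (auto simp: mat_diag_def)
  moreover have "Y * Y - Y * Y = 0\<^sub>m n n" using assms by (intro eq_matI) auto
  ultimately have "psd_mat (Y * Y - X * X)" "psd_mat (X * X - Y * Y)"
    unfolding assms(5) by simp_all
  thus "psd_mat (Y - X)" "psd_mat (X - Y)"
    using psd_mat_sqrt_mono assms(1-4) by blast+
qed (use assms in auto)

text \<open>Existence and uniqueness discharge the definite description in \<open>psd_sqrt\<close>;
  everything later uses only these three properties.\<close>

lemma psd_sqrt:
  assumes A: "A \<in> carrier_mat n n" "psd_mat A"
  shows "psd_sqrt A \<in> carrier_mat n n"
    and "psd_mat (psd_sqrt A)"
    and "psd_sqrt A * psd_sqrt A = A"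
proof -
  from psd_mat_sqrt_exists[OF A] obtain B where B: "B \<in> carrier_mat n n" "psd_mat B" "B * B = A" by blast
  have "psd_sqrt A = B"
    unfolding psd_sqrt_def
  proof (rule the_equality)
    \<comment> \<open>The description does not fix the size of a candidate; it follows from
      \<open>C\<close> being square with \<open>C * C = A\<close>.\<close>
    fix C assume C: "psd_mat C \<and> C * C = A"
    hence "dim_row C = dim_row (C * C)" "dim_col C = dim_row C"
      by (auto simp: psd_mat_def hermitian_mat_def)
    hence "C \<in> carrier_mat n n" using A C by (intro carrier_matI) auto
    thus "C = B" using psd_mat_sqrt_unique[of C n B] B C by simp
  qed (use B in auto)
  thus "psd_sqrt A \<in> carrier_mat n n" "psd_mat (psd_sqrt A)" "psd_sqrt A * psd_sqrt A = A"
    using B by auto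
qed

section \<open>Gram matrices and the comparison of absolute values\<close>

lemma psd_mat_one: "psd_mat (1\<^sub>m n)"
  using psd_mat_diag[of n "\<lambda>_. 1"] by simp

lemma psd_mat_gram:
  assumes "B \<in> carrier_mat n n"
  shows "psd_mat (mat_adjoint B * B)"
  using psd_mat_congruence[of "1\<^sub>m n" n B] psd_mat_one assms by simp

lemma smult_mat_mult_vec:
  fixes A :: "complex mat"
  assumes "A \<in> carrier_mat n m" "x \<in> carrier_vec m"
  shows "(c \<cdot>\<^sub>m A) *\<^sub>v x = c \<cdot>\<^sub>v (A *\<^sub>v x)"
  using assms by (intro eq_vecI) auto

lemma psd_mat_smult:
  assumes "A \<in> carrier_mat n n" "psd_mat A" "0 \<le> c"
  shows "psd_mat (complex_of_real c \<cdot>\<^sub>m A)"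
  using assms by (simp add: psd_mat_iff[of _ n] smult_mat_mult_vec[of _ n n])

lemma mat_abs:
  assumes X: "X \<in> carrier_mat n n"
  shows "mat_abs X \<in> carrier_mat n n" "psd_mat (mat_abs X)" "mat_abs X * mat_abs X = mat_adjoint X * X"
  unfolding mat_abs_def
  using psd_sqrt[OF mult_carrier_mat[OF mat_adjoint_carrier[OF X] X] psd_mat_gram[OF X]] .

text \<open>Both sides are positive semidefinite and their squares are the Gram matrices in the
  hypothesis, so operator monotonicity of the square root applies. This turns the goal into an
  inequality free of square roots of \<open>mat_adjoint T * T\<close>.\<close>

lemma mat_abs_loewner_leI:
  assumes T: "T \<in> carrier_mat n n" and X: "X \<in> carrier_mat n n" and c: "0 \<le> c"
    and le: "psd_mat (complex_of_real (c\<^sup>2) \<cdot>\<^sub>m (mat_adjoint X * X) - mat_adjoint T * T)"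
  shows "loewner_le (mat_abs T) (complex_of_real c \<cdot>\<^sub>m mat_abs X)"
proof -
  note T' = mat_abs[OF T]
  note X' = mat_abs[OF X]
  let ?Y = "complex_of_real c \<cdot>\<^sub>m mat_abs X"
  have Y: "?Y \<in> carrier_mat n n" "psd_mat ?Y" using X' c by (auto intro: psd_mat_smult)
  have "?Y * ?Y = complex_of_real (c\<^sup>2) \<cdot>\<^sub>m (mat_adjoint X * X)"
    using X'(1) by (simp add: mult_smult_assoc_mat[of _ n n _ n] mult_smult_distrib[of _ n n _ n]
        X'(3) power2_eq_square) (auto intro!: eq_matI)
  hence "psd_mat (?Y * ?Y - mat_abs T * mat_abs T)"
    using le unfolding T'(3) by simp
  hence "psd_mat (?Y - mat_abs T)"
    by (rule psd_mat_sqrt_mono[OF T'(1,2) Y])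
  thus ?thesis using T' Y by (auto simp: loewner_le_def psd_mat_def)
qed

text \<open>For Hermitian \<open>C\<close> the eigenvalue \<open>d i\<close> is the value of the
  quadratic form at the unit vector \<open>col U i\<close>, so its absolute value is at most t. In
  the eigenbasis the matrix in the conclusion is diagonal with entries t^2 - (d i)^2.\<close>

lemma numerical_radius_bound:
  assumes C: "C \<in> carrier_mat n n" "mat_adjoint C = C"
    and bd: "\<And>x. x \<in> carrier_vec n \<Longrightarrow> \<bar>Re ((C *\<^sub>v x) \<bullet>c x)\<bar> \<le> t * Re (x \<bullet>c x)"
  shows "psd_mat (complex_of_real (t\<^sup>2) \<cdot>\<^sub>m 1\<^sub>m n - C * C)"
proof -
  obtain U d where U: "U \<in> carrier_mat n n" "mat_adjoint U * U = 1\<^sub>m n" "U * mat_adjoint U = 1\<^sub>m n"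
    "C = U * mat_diag n (\<lambda>i. complex_of_real (d i)) * mat_adjoint U"
    "\<And>i. i < n \<Longrightarrow> C *\<^sub>v col U i = complex_of_real (d i) \<cdot>\<^sub>v col U i"
    "\<And>i. i < n \<Longrightarrow> col U i \<bullet>c col U i = 1"
    by (rule hermitian_eigenbasis[OF C]) blast
  note assoc = assoc_mult_mat[of _ n n _ n _ n] mult_carrier_mat[of _ n n _ n]
  let ?D = "mat_diag n (\<lambda>i. complex_of_real (d i))"
  let ?E = "mat_diag n (\<lambda>i. complex_of_real (t\<^sup>2 - (d i)\<^sup>2))"
  have d: "(d i)\<^sup>2 \<le> t\<^sup>2" if i: "i < n" for i
  proof -
    have cu: "col U i \<in> carrier_vec n" using U(1) i by simp
    have "Re ((C *\<^sub>v col U i) \<bullet>c col U i) = d i"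
      unfolding U(5)[OF i] using U(6)[OF i] cu by simp
    hence "\<bar>d i\<bar> \<le> t" using bd[OF cu] U(6)[OF i] by simp
    thus ?thesis by (metis abs_ge_zero power2_abs power_mono)
  qed
  have "C * C = U * ?D * (mat_adjoint U * U) * ?D * mat_adjoint U"
    unfolding U(4) using U(1) by (simp add: assoc)
  also have "\<dots> = U * (?D * ?D) * mat_adjoint U"
    unfolding U(2) using U(1) by (simp add: assoc left_mult_one_mat[of _ n n])
  finally have "complex_of_real (t\<^sup>2) \<cdot>\<^sub>m 1\<^sub>m n - C * C
      = U * (complex_of_real (t\<^sup>2) \<cdot>\<^sub>m 1\<^sub>m n - ?D * ?D) * mat_adjoint U"
    using U(1,3) by (simp add: mult_minus_distrib_mat[of _ n n _ n] minus_mult_distrib_mat[of _ n n _ _ n]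
        mult_smult_assoc_mat[of _ n n _ n] mult_smult_distrib[of _ n n _ n])
  also have "complex_of_real (t\<^sup>2) \<cdot>\<^sub>m 1\<^sub>m n - ?D * ?D = ?E"
    unfolding mat_diag_diag by (intro eq_matI) (auto simp: mat_diag_def power2_eq_square)
  finally have "complex_of_real (t\<^sup>2) \<cdot>\<^sub>m 1\<^sub>m n - C * C = U * ?E * mat_adjoint U" .
  moreover have "psd_mat ?E" using d by (intro psd_mat_diag) simp
  from psd_mat_congruence[OF _ this, of n "mat_adjoint U"] U(1)
  have "psd_mat (U * ?E * mat_adjoint U)" by simp
  ultimately show ?thesis by simp
qed

section \<open>Invertible matrices and the polar decomposition\<close>

lemma obtain_inverse_mat:
  fixes A :: "complex mat"
  assumes "A \<in> carrier_mat n n" "det A \<noteq> 0"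
  obtains B where "B \<in> carrier_mat n n" "A * B = 1\<^sub>m n" "B * A = 1\<^sub>m n"
  \<comment> \<open>\<open>undefined\<close> fills the record extension of the matrix ring
    \<open>ring_mat\<close>, whose units are the invertible matrices.\<close>
  using det_non_zero_imp_unit[OF assms, of undefined] by (auto simp: Units_def ring_mat_def)

lemma det_adjoint_nonzero:
  fixes A :: "complex mat"
  assumes A: "A \<in> carrier_mat n n" "det A \<noteq> 0"
  shows "det (mat_adjoint A) \<noteq> 0"
proof -
  obtain B where B: "B \<in> carrier_mat n n" "A * B = 1\<^sub>m n" by (rule obtain_inverse_mat[OF A]) blast
  have "mat_adjoint B * mat_adjoint A = 1\<^sub>m n"
    using arg_cong[OF B(2), of mat_adjoint] by (simp only: mat_adjoint_mult[OF A(1) B(1)] mat_adjoint_one)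
  hence "det (mat_adjoint B) * det (mat_adjoint A) = 1"
    using det_mult[of "mat_adjoint B" n "mat_adjoint A"] A B by simp
  thus ?thesis by auto
qed

text \<open>Write M = P Q with P the positive square root of \<open>M * mat_adjoint M\<close> and Q
  = P^{-1} M. The factorization is stated through its consequence that the two Gram matrices of
  \<open>M\<close> are unitarily similar, the form in which it is applied.\<close>

lemma polar_decomposition:
  fixes M :: "complex mat"
  assumes M: "M \<in> carrier_mat n n" "det M \<noteq> 0"
  obtains Q where "Q \<in> carrier_mat n n" "mat_adjoint Q * Q = 1\<^sub>m n"
    "mat_adjoint M * M = mat_adjoint Q * (M * mat_adjoint M) * Q"
proof -
  note assoc = assoc_mult_mat[of _ n n _ n _ n] mult_carrier_mat[of _ n n _ n]
  define P where "P = psd_sqrt (M * mat_adjoint M)"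
  have "psd_mat (M * mat_adjoint M)"
    using psd_mat_gram[of "mat_adjoint M" n] M by simp
  from psd_sqrt[OF _ this, of n] M(1)
  have P: "P \<in> carrier_mat n n" "psd_mat P" "P * P = M * mat_adjoint M"
    unfolding P_def by auto
  have Ph: "mat_adjoint P = P" using P by (simp add: psd_mat_iff)
  \<comment> \<open>Determinants of \<open>P * P = M * mat_adjoint M\<close> show that
    \<open>P\<close> is invertible, so that its inverse \<open>N\<close> can define
    \<open>Q\<close>.\<close>
  have "det P * det P = det M * det (mat_adjoint M)"
    using arg_cong[OF P(3), of det]
    by (simp only: det_mult[OF P(1) P(1)] det_mult[OF M(1) mat_adjoint_carrier[OF M(1)]])
  hence "det P \<noteq> 0" using M det_adjoint_nonzero[OF M] by auto
  then obtain N where N: "N \<in> carrier_mat n n" "P * N = 1\<^sub>m n" "N * P = 1\<^sub>m n"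
    by (rule obtain_inverse_mat[OF P(1)])
  have Nh: "mat_adjoint N * P = 1\<^sub>m n"
    using arg_cong[OF N(2), of mat_adjoint] by (simp only: mat_adjoint_mult[OF P(1) N(1)] mat_adjoint_one Ph)
  define Q where "Q = N * M"
  have Q: "Q \<in> carrier_mat n n" using N M by (simp add: Q_def)
  have "Q * mat_adjoint Q = N * (M * mat_adjoint M) * mat_adjoint N"
    using N(1) M(1) by (simp add: Q_def mat_adjoint_mult[of _ n n _ n] assoc)
  also have "\<dots> = (N * P) * (P * mat_adjoint N)"
    unfolding P(3)[symmetric] using N(1) P(1) by (simp add: assoc)
  also have "P * mat_adjoint N = 1\<^sub>m n"
    using mat_mult_left_right_inverse[OF _ P(1) Nh] N(1) by simp
  finally have "Q * mat_adjoint Q = 1\<^sub>m n" unfolding N(3) by simp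
  from mat_mult_left_right_inverse[OF Q _ this] Q
  have QQ: "mat_adjoint Q * Q = 1\<^sub>m n" by simp
  have "P * Q = (P * N) * M" using P(1) N(1) M(1) by (simp add: Q_def assoc)
  hence "M = P * Q" unfolding N(2) using M(1) by simp
  hence "mat_adjoint M * M = mat_adjoint Q * (P * P) * Q"
    using P(1) Q by (simp add: mat_adjoint_mult[of _ n n _ n] Ph assoc)
  thus thesis using that Q QQ unfolding P(3) by blast
qed

section \<open>Sectorial matrices and the real part\<close>

lemma cscalar_prod_mat_adjoint:
  fixes A :: "complex mat"
  assumes A: "A \<in> carrier_mat n n" and x: "x \<in> carrier_vec n"
  shows "(mat_adjoint A *\<^sub>v x) \<bullet>c x = cnj ((A *\<^sub>v x) \<bullet>c x)"
proof -
  have Ax: "A *\<^sub>v x \<in> carrier_vec n" using mult_mat_vec_carrier[OF A x] .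
  have "(mat_adjoint A *\<^sub>v x) \<bullet>c x = x \<bullet>c (A *\<^sub>v x)"
    using cscalar_prod_adjoint[OF mat_adjoint_carrier[OF A] x x] by simp
  also have "\<dots> = conjugate (A *\<^sub>v x) \<bullet> x"
    by (rule conjugate_vec_sprod_comm[OF x Ax])
  also have "\<dots> = cnj ((A *\<^sub>v x) \<bullet>c x)"
    using conjugate_conjugate_sprod[OF Ax x] by (metis complex_cnj_cnj conjugate_complex_def)
  finally show ?thesis .
qed

lemma sectorial_carrier: "T \<in> sectorial n \<alpha> \<Longrightarrow> T \<in> carrier_mat n n"
  by (simp add: sectorial_def)

text \<open>The definition speaks of unit vectors only. Scaling x by a real r multiplies the
  quadratic form by r^2, which preserves both conditions, so normalising x suffices.\<close>

lemma sectorial_quad_form: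
  assumes T: "T \<in> sectorial n \<alpha>" and x: "x \<in> carrier_vec n" "x \<noteq> 0\<^sub>v n"
  shows "0 < Re ((T *\<^sub>v x) \<bullet>c x)"
    and "\<bar>Im ((T *\<^sub>v x) \<bullet>c x)\<bar> \<le> tan \<alpha> * Re ((T *\<^sub>v x) \<bullet>c x)"
proof -
  note Tc = sectorial_carrier[OF T]
  define s where "s = Re (x \<bullet>c x)"
  have s: "0 < s" "x \<bullet>c x = complex_of_real s"
    unfolding s_def using cscalar_prod_self_pos[OF x] cscalar_prod_self_real(1) by auto
  define r where "r = 1 / sqrt s"
  have r: "0 < r" "r * r * s = 1" using s(1) by (auto simp: r_def)
  have scale: "(complex_of_real r \<cdot>\<^sub>v u) \<bullet>c (complex_of_real r \<cdot>\<^sub>v x) = complex_of_real (r * r) * (u \<bullet>c x)"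
    if "u \<in> carrier_vec n" for u
    using that x by (simp add: conjugate_smult_vec smult_scalar_prod_distrib[of _ n]
        scalar_prod_smult_distrib[of _ n])
  define y where "y = complex_of_real r \<cdot>\<^sub>v x"
  have y: "y \<in> carrier_vec n" using x by (simp add: y_def)
  have "y \<bullet>c y = complex_of_real (r * r * s)"
    unfolding y_def scale[OF x(1)] s(2) by simp
  hence "y \<bullet>c y = 1" unfolding r(2) by simp
  hence Ty: "0 < Re ((T *\<^sub>v y) \<bullet>c y)" "\<bar>Im ((T *\<^sub>v y) \<bullet>c y)\<bar> \<le> tan \<alpha> * Re ((T *\<^sub>v y) \<bullet>c y)"
    using T y by (auto simp: sectorial_def quad_form_def)
  have q: "(T *\<^sub>v y) \<bullet>c y = complex_of_real (r * r) * ((T *\<^sub>v x) \<bullet>c x)"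
    unfolding y_def mult_mat_vec[OF Tc x(1)] by (rule scale[OF mult_mat_vec_carrier[OF Tc x(1)]])
  have rr: "0 < r * r" using r by simp
  have ReIm: "Re ((T *\<^sub>v y) \<bullet>c y) = (r * r) * Re ((T *\<^sub>v x) \<bullet>c x)"
    "Im ((T *\<^sub>v y) \<bullet>c y) = (r * r) * Im ((T *\<^sub>v x) \<bullet>c x)"
    unfolding q by simp_all
  show "0 < Re ((T *\<^sub>v x) \<bullet>c x)"
    using Ty(1) rr unfolding ReIm by (simp add: zero_less_mult_iff)
  have "(r * r) * \<bar>Im ((T *\<^sub>v x) \<bullet>c x)\<bar> \<le> (r * r) * (tan \<alpha> * Re ((T *\<^sub>v x) \<bullet>c x))"
    using Ty(2) unfolding ReIm by (simp add: abs_mult mult_ac)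
  thus "\<bar>Im ((T *\<^sub>v x) \<bullet>c x)\<bar> \<le> tan \<alpha> * Re ((T *\<^sub>v x) \<bullet>c x)"
    using rr by (simp only: mult_le_cancel_left_pos)
qed

text \<open>A nonzero kernel vector would give the quadratic form the value 0. The lemma yields
  invertibility of both \<open>T\<close> and \<open>re_part T\<close>.\<close>

lemma det_nonzero_quad_form:
  fixes A :: "complex mat"
  assumes A: "A \<in> carrier_mat n n"
    and pos: "\<And>x. x \<in> carrier_vec n \<Longrightarrow> x \<noteq> 0\<^sub>v n \<Longrightarrow> 0 < Re ((A *\<^sub>v x) \<bullet>c x)"
  shows "det A \<noteq> 0"
proof
  assume "det A = 0"
  then obtain v where v: "v \<in> carrier_vec n" "v \<noteq> 0\<^sub>v n" "A *\<^sub>v v = 0\<^sub>v n"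
    using det_0_iff_vec_prod_zero_field[OF A] by blast
  from pos[OF v(1,2)] show False unfolding v(3) using v(1) by simp
qed

lemma re_part_carrier: "T \<in> carrier_mat n n \<Longrightarrow> re_part T \<in> carrier_mat n n"
  by (simp add: re_part_def)

lemma re_part_quad_form:
  assumes T: "T \<in> carrier_mat n n" and x: "x \<in> carrier_vec n"
  shows "(re_part T *\<^sub>v x) \<bullet>c x = complex_of_real (Re ((T *\<^sub>v x) \<bullet>c x))"
proof -
  have "re_part T *\<^sub>v x = (1/2) \<cdot>\<^sub>v (T *\<^sub>v x + mat_adjoint T *\<^sub>v x)"
    using T x by (simp add: re_part_def smult_mat_mult_vec[of _ n n] add_mult_distrib_mat_vec[of _ n n])
  hence "(re_part T *\<^sub>v x) \<bullet>c x = (1/2) * ((T *\<^sub>v x) \<bullet>c x + (mat_adjoint T *\<^sub>v x) \<bullet>c x)"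
    using T x mult_mat_vec_carrier[OF T x] mult_mat_vec_carrier[OF mat_adjoint_carrier[OF T] x]
    by (simp add: smult_scalar_prod_distrib[of _ n] add_scalar_prod_distrib[of _ n])
  thus ?thesis
    unfolding cscalar_prod_mat_adjoint[OF T x] complex_add_cnj by simp
qed

lemma sectorial_re_part_psd:
  assumes T: "T \<in> sectorial n \<alpha>"
  shows "psd_mat (re_part T)"
proof -
  note Tc = sectorial_carrier[OF T]
  have "mat_adjoint (re_part T) = re_part T"
    using Tc by (auto simp: re_part_def mat_adjoint_add[of _ n n] comm_add_mat[of _ n n])
  moreover have "0 \<le> Re ((re_part T *\<^sub>v x) \<bullet>c x)" if x: "x \<in> carrier_vec n" for x
    using sectorial_quad_form(1)[OF T x] x mult_mat_vec_carrier[OF Tc x]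
    unfolding re_part_quad_form[OF Tc x] by (cases "x = 0\<^sub>v n") auto
  ultimately show ?thesis using psd_mat_iff[OF re_part_carrier[OF Tc]] by blast
qed

section \<open>Factorization of a sectorial matrix through its real part\<close>

lemma mult_adjoint_one_plus_ii:
  assumes C: "C \<in> carrier_mat n n" "mat_adjoint C = C"
  shows "(1\<^sub>m n + \<i> \<cdot>\<^sub>m C) * mat_adjoint (1\<^sub>m n + \<i> \<cdot>\<^sub>m C) = 1\<^sub>m n + C * C"
proof -
  have iC: "\<i> \<cdot>\<^sub>m C \<in> carrier_mat n n" "(- \<i>) \<cdot>\<^sub>m C \<in> carrier_mat n n" using C by auto
  have "mat_adjoint (1\<^sub>m n + \<i> \<cdot>\<^sub>m C) = 1\<^sub>m n + (- \<i>) \<cdot>\<^sub>m C"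
    using mat_adjoint_add[OF one_carrier_mat iC(1)] C(2) by simp
  moreover have "(1\<^sub>m n + \<i> \<cdot>\<^sub>m C) * (1\<^sub>m n + (- \<i>) \<cdot>\<^sub>m C)
      = (1\<^sub>m n + \<i> \<cdot>\<^sub>m C) + (- \<i>) \<cdot>\<^sub>m (C + \<i> \<cdot>\<^sub>m (C * C))"
    using C iC by (simp add: mult_add_distrib_mat[of _ n n _ n] add_mult_distrib_mat[of _ n n _ _ n]
        mult_smult_distrib[of _ n n _ n] mult_smult_assoc_mat[of _ n n _ n])
  moreover have "\<dots> = 1\<^sub>m n + C * C"
    using C(1) by (intro eq_matI) (auto simp: algebra_simps)
  ultimately show ?thesis by simp
qed

text \<open>The choice K = S^{-1} T S^{-1} normalises the real part to the identity, so the sector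
  condition becomes a bound on the imaginary part \<open>C\<close> of \<open>K\<close> alone. The
  determinant condition prepares the polar decomposition of \<open>S * K\<close>, and 1 + (tan
  \<alpha>)^2 is the square of sec \<alpha>.\<close>

lemma sectorial_factorization:
  assumes T: "T \<in> sectorial n \<alpha>" and S: "S = psd_sqrt (re_part T)"
  obtains K where "K \<in> carrier_mat n n" "T = S * K * S" "det (S * K) \<noteq> 0"
    "psd_mat (complex_of_real (1 + (tan \<alpha>)\<^sup>2) \<cdot>\<^sub>m 1\<^sub>m n - K * mat_adjoint K)"
proof -
  note Tc = sectorial_carrier[OF T]
  note assoc = assoc_mult_mat[of _ n n _ n _ n] mult_carrier_mat[of _ n n _ n]
  let ?A = "re_part T"
  note A = re_part_carrier[OF Tc] sectorial_re_part_psd[OF T]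
  note SS = psd_sqrt[OF A, folded S]
  have Sh: "mat_adjoint S = S" using SS by (simp add: psd_mat_iff)
  have detT: "det T \<noteq> 0"
    using det_nonzero_quad_form[OF Tc sectorial_quad_form(1)[OF T]] .
  have "det ?A \<noteq> 0"
  proof (rule det_nonzero_quad_form[OF A(1)])
    fix x :: "complex vec" assume x: "x \<in> carrier_vec n" "x \<noteq> 0\<^sub>v n"
    show "0 < Re ((?A *\<^sub>v x) \<bullet>c x)"
      unfolding re_part_quad_form[OF Tc x(1)] using sectorial_quad_form(1)[OF T x] by simp
  qed
  hence "det S \<noteq> 0"
    using det_mult[OF SS(1) SS(1)] unfolding SS(3) by auto
  then obtain R where R: "R \<in> carrier_mat n n" "S * R = 1\<^sub>m n" "R * S = 1\<^sub>m n"
    by (rule obtain_inverse_mat[OF SS(1)])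
  \<comment> \<open>The inverse of a Hermitian matrix is Hermitian: \<open>mat_adjoint R\<close> is
    also a left inverse of \<open>S\<close>, hence equal to \<open>R\<close>.\<close>
  have "mat_adjoint R * S = 1\<^sub>m n"
    using arg_cong[OF R(2), of mat_adjoint] by (simp only: mat_adjoint_mult[OF SS(1) R(1)] mat_adjoint_one Sh)
  hence "mat_adjoint R * (S * R) = R"
    using SS(1) R(1) by (simp flip: assoc_mult_mat[of _ n n _ n _ n])
  hence Rh: "mat_adjoint R = R" unfolding R(2) using R(1) by simp
  define K where "K = R * T * R"
  have K: "K \<in> carrier_mat n n" using R Tc by (simp add: K_def mult_carrier_mat[of _ n n _ n])
  have "S * K = (S * R) * (T * R)"
    using R(1) SS(1) Tc by (simp add: K_def assoc)
  hence SK: "S * K = T * R" unfolding R(2) using R(1) Tc by (simp add: assoc left_mult_one_mat[of _ n n])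
  have "T * R * S = T * (R * S)" using R(1) SS(1) Tc by (simp add: assoc)
  hence TSKS: "T = S * K * S" unfolding SK R(3) using Tc by simp
  have "det (S * K) * det S \<noteq> 0"
    using detT det_mult[OF mult_carrier_mat[OF SS(1) K] SS(1)] TSKS by simp
  hence detSK: "det (S * K) \<noteq> 0" by auto

  \<comment> \<open>Since -i/2 = 1/(2i), this is the Hermitian imaginary part of
    \<open>K\<close>.\<close>
  define C where "C = (- \<i> / 2) \<cdot>\<^sub>m (K - mat_adjoint K)"
  have C: "C \<in> carrier_mat n n" using K by (simp add: C_def minus_carrier_mat[of _ n n])
  have Ch: "mat_adjoint C = C"
    using K by (intro eq_matI) (auto simp: C_def algebra_simps)
  have Kadj: "mat_adjoint K = R * mat_adjoint T * R"
    using R(1) Tc by (simp add: K_def mat_adjoint_mult[of _ n n _ n] Rh assoc)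
  \<comment> \<open>Twice the real part of \<open>T\<close> is 2 S^2, and the inverses
    \<open>R\<close> on both sides cancel the two factors \<open>S\<close>: the real part of
    \<open>K\<close> is the identity.\<close>
  have "K + mat_adjoint K = R * (T + mat_adjoint T) * R"
    unfolding Kadj unfolding K_def using R(1) Tc
    by (simp add: mult_add_distrib_mat[of _ n n _ n] add_mult_distrib_mat[of _ n n _ _ n] assoc)
  also have "T + mat_adjoint T = 2 \<cdot>\<^sub>m (S * S)"
    unfolding SS(3) using Tc by (intro eq_matI) (auto simp: re_part_def)
  also have "R * (2 \<cdot>\<^sub>m (S * S)) * R = 2 \<cdot>\<^sub>m ((R * S) * (S * R))"
    using R(1) SS(1) by (simp add: assoc mult_smult_distrib[of _ n n _ n] mult_smult_assoc_mat[of _ n n _ n])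
  finally have K2: "K + mat_adjoint K = 2 \<cdot>\<^sub>m 1\<^sub>m n" unfolding R(2,3) by simp
  have KC: "K = 1\<^sub>m n + \<i> \<cdot>\<^sub>m C"
  proof (rule eq_matI)
    fix i j assume "i < dim_row (1\<^sub>m n + \<i> \<cdot>\<^sub>m C)" "j < dim_col (1\<^sub>m n + \<i> \<cdot>\<^sub>m C)"
    hence ij: "i < n" "j < n" using C by auto
    have "1\<^sub>m n $$ (i, j) = (K $$ (i, j) + cnj (K $$ (j, i))) / 2"
      using arg_cong[OF K2, of "\<lambda>M. M $$ (i, j)"] K ij by simp
    moreover have "(1\<^sub>m n + \<i> \<cdot>\<^sub>m C) $$ (i, j)
        = 1\<^sub>m n $$ (i, j) + (K $$ (i, j) - cnj (K $$ (j, i))) / 2"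
      using K ij by (simp add: C_def diff_divide_distrib)
    ultimately show "K $$ (i, j) = (1\<^sub>m n + \<i> \<cdot>\<^sub>m C) $$ (i, j)"
      by (simp only:) (simp add: field_simps)
  qed (use K C in auto)

  have "psd_mat (complex_of_real ((tan \<alpha>)\<^sup>2) \<cdot>\<^sub>m 1\<^sub>m n - C * C)"
  proof (rule numerical_radius_bound[OF C Ch])
    fix x :: "complex vec" assume x: "x \<in> carrier_vec n"
    \<comment> \<open>With y = S^{-1} x the form of \<open>K\<close> at x equals that of
      \<open>T\<close> at y. Its real part is the squared norm of x and its imaginary part is the
      form of \<open>C\<close> at x, so the sector condition for \<open>T\<close> at y is the
      required bound.\<close>
    define y where "y = R *\<^sub>v x"
    have y: "y \<in> carrier_vec n" using R(1) x by (simp add: y_def mult_mat_vec_carrier[of _ n n])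
    have Ty: "T *\<^sub>v y \<in> carrier_vec n" using mult_mat_vec_carrier[OF Tc y] .
    have "K *\<^sub>v x = R *\<^sub>v (T *\<^sub>v y)"
      using R(1) Tc x by (simp add: K_def y_def assoc_mult_mat_vec[of _ n n _ n]
          mult_carrier_mat[of _ n n _ n] mult_mat_vec_carrier[of _ n n])
    hence Kq: "(K *\<^sub>v x) \<bullet>c x = (T *\<^sub>v y) \<bullet>c y"
      using cscalar_prod_adjoint[OF R(1) Ty x] by (simp add: Rh y_def)
    have Cx: "C *\<^sub>v x \<in> carrier_vec n" using mult_mat_vec_carrier[OF C x] .
    have "K *\<^sub>v x = x + \<i> \<cdot>\<^sub>v (C *\<^sub>v x)"
      unfolding KC using C x by (simp add: add_mult_distrib_mat_vec[of _ n n] smult_mat_mult_vec[of _ n n])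
    hence "(K *\<^sub>v x) \<bullet>c x = x \<bullet>c x + \<i> * ((C *\<^sub>v x) \<bullet>c x)"
      using x Cx by (simp add: add_scalar_prod_distrib[of _ n] smult_scalar_prod_distrib[of _ n])
    moreover have "(C *\<^sub>v x) \<bullet>c x = cnj ((C *\<^sub>v x) \<bullet>c x)"
      using cscalar_prod_mat_adjoint[OF C x] unfolding Ch .
    hence "Im ((C *\<^sub>v x) \<bullet>c x) = 0" by (metis Reals_cnj_iff complex_is_Real_iff)
    moreover have "Im (x \<bullet>c x) = 0"
      using cscalar_prod_self_real(1)[of x] by (metis Im_complex_of_real)
    ultimately have q: "Re ((T *\<^sub>v y) \<bullet>c y) = Re (x \<bullet>c x)" "Im ((T *\<^sub>v y) \<bullet>c y) = Re ((C *\<^sub>v x) \<bullet>c x)"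
      unfolding Kq by simp_all
    show "\<bar>Re ((C *\<^sub>v x) \<bullet>c x)\<bar> \<le> tan \<alpha> * Re (x \<bullet>c x)"
    \<comment> \<open>The sector estimate is available for nonzero y; for y = 0 the identities
      \<open>q\<close> make both sides vanish.\<close>
    proof (cases "y = 0\<^sub>v n")
      case True
      hence "(T *\<^sub>v y) \<bullet>c y = 0" using Ty by simp
      thus ?thesis using q by simp
    next
      case False
      show ?thesis using sectorial_quad_form(2)[OF T y False] unfolding q .
    qed
  qed
  moreover have "complex_of_real (1 + (tan \<alpha>)\<^sup>2) \<cdot>\<^sub>m 1\<^sub>m n - (1\<^sub>m n + C * C)
      = complex_of_real ((tan \<alpha>)\<^sup>2) \<cdot>\<^sub>m 1\<^sub>m n - C * C"
    using C by (intro eq_matI) (auto simp: algebra_simps)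
  ultimately have "psd_mat (complex_of_real (1 + (tan \<alpha>)\<^sup>2) \<cdot>\<^sub>m 1\<^sub>m n - K * mat_adjoint K)"
    using mult_adjoint_one_plus_ii[OF C Ch] by (simp flip: KC)
  thus thesis using that[OF K TSKS detSK] by blast
qed

theorem theorem2p7:
  fixes \<alpha> :: real and n :: nat and T :: "complex mat"
  assumes "0 \<le> \<alpha>" and "\<alpha> < pi / 2"
    and "T \<in> sectorial n \<alpha>"
  shows "\<exists>U \<in> carrier_mat n n. unitary_mat U \<and>
    loewner_le (mat_abs T)
      (complex_of_real (1 / cos \<alpha>) \<cdot>\<^sub>m mat_abs (psd_sqrt (re_part T) * U * psd_sqrt (re_part T)))"
proof -
  note T = assms(3)
  note Tc = sectorial_carrier[OF T]
  note assoc = assoc_mult_mat[of _ n n _ n _ n] mult_carrier_mat[of _ n n _ n]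
  define S where "S = psd_sqrt (re_part T)"
  have S: "S \<in> carrier_mat n n" "psd_mat S"
    unfolding S_def using psd_sqrt[OF re_part_carrier[OF Tc] sectorial_re_part_psd[OF T]] by auto
  have Sh: "mat_adjoint S = S" using S by (simp add: psd_mat_iff)
  obtain K where K: "K \<in> carrier_mat n n" "T = S * K * S" "det (S * K) \<noteq> 0"
    "psd_mat (complex_of_real (1 + (tan \<alpha>)\<^sup>2) \<cdot>\<^sub>m 1\<^sub>m n - K * mat_adjoint K)"
    by (rule sectorial_factorization[OF T S_def])
  have SK: "S * K \<in> carrier_mat n n" using S K by (simp add: assoc)
  \<comment> \<open>Decomposing \<open>S * K\<close>, not \<open>K\<close>, moves the factor
    \<open>K\<close> and its adjoint next to each other, where the bound on their product applies.
    This \<open>Q\<close> is the unitary of the conclusion.\<close>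
  obtain Q where Q: "Q \<in> carrier_mat n n" "mat_adjoint Q * Q = 1\<^sub>m n"
    "mat_adjoint (S * K) * (S * K) = mat_adjoint Q * (S * K * mat_adjoint (S * K)) * Q"
    by (rule polar_decomposition[OF SK K(3)])
  define X where "X = S * Q * S"
  define L where "L = K * mat_adjoint K"
  have X: "X \<in> carrier_mat n n" using S Q by (simp add: X_def assoc)
  have L: "L \<in> carrier_mat n n" using K by (simp add: L_def assoc)
  have cos: "0 < cos \<alpha>" using assms(1,2) by (intro cos_gt_zero_pi) auto
  have sec: "(1 / cos \<alpha>)\<^sup>2 = 1 + (tan \<alpha>)\<^sup>2"
    using cos tan_sec[of \<alpha>] by (simp add: inverse_eq_divide)
  have "mat_adjoint T * T = S * (mat_adjoint (S * K) * (S * K)) * S"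
    using S(1) K(1) by (subst (1 2) K(2)) (simp add: mat_adjoint_mult[of _ n n _ n] Sh assoc)
  \<comment> \<open>The middle factor is S L S conjugated by \<open>Q\<close>; its outer factors
    \<open>S\<close>, together with \<open>Q\<close> and the outermost \<open>S\<close>, assemble to
    \<open>X\<close> and its adjoint.\<close>
  also have "\<dots> = mat_adjoint X * L * X"
    unfolding Q(3) using S(1) Q(1) K(1)
    by (simp add: X_def L_def mat_adjoint_mult[of _ n n _ n] Sh assoc)
  finally have TT: "mat_adjoint T * T = mat_adjoint X * L * X" .
  \<comment> \<open>The bound on \<open>L\<close> is carried through the congruence by
    \<open>X\<close>; expanding it gives the comparison of Gram matrices required by
    \<open>mat_abs_loewner_leI\<close>.\<close>
  have "psd_mat (mat_adjoint X * (complex_of_real (1 + (tan \<alpha>)\<^sup>2) \<cdot>\<^sub>m 1\<^sub>m n - L) * X)"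
    using K(4) by (intro psd_mat_congruence[OF minus_carrier_mat[OF L] _ X]) (simp add: L_def)
  also have "mat_adjoint X * (complex_of_real (1 + (tan \<alpha>)\<^sup>2) \<cdot>\<^sub>m 1\<^sub>m n - L) * X
      = complex_of_real ((1 / cos \<alpha>)\<^sup>2) \<cdot>\<^sub>m (mat_adjoint X * X) - mat_adjoint T * T"
    unfolding TT sec using X L
    by (simp add: assoc mult_minus_distrib_mat[of _ n n _ n] minus_mult_distrib_mat[of _ n n _ _ n]
        mult_smult_distrib[of _ n n _ n] mult_smult_assoc_mat[of _ n n _ n])
  finally have "loewner_le (mat_abs T) (complex_of_real (1 / cos \<alpha>) \<cdot>\<^sub>m mat_abs X)"
    using cos by (intro mat_abs_loewner_leI[OF Tc X]) auto
  thus ?thesis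
    using Q(1) unitary_matI[OF Q(1,2)] unfolding X_def S_def by blast
qed

end
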